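(* The function $\varphi(s)=\int_0^\infty e^{-st}\rho(t)\,dt$, $s\ge 0$, is square integrable on $[0,\infty)$, and $$ \lim_{a\to 0^+}\int_{-\infty}^\infty |1-G(a+it)|^2\,\frac{dt}{2\pi}=\int_{-\infty}^\infty |1-G(it)|^2\,\frac{dt}{2\pi}=\int_0^\infty \varphi^2(s)\,ds. $$
   Context: Let $\mathcal A=\mathbb C\setminus(-\infty,0]$ and let $\operatorname{Log} z=\ln|z|+i\operatorname{Arg} z$ be the principal logarithm on $\mathcal A$, with $-\pi<\operatorname{Arg} z<\pi$. The function $G$ is defined by $$ G(z)=\left(1-\frac{\operatorname{Log} z}{\operatorname{Log}(1+z)}\right)z\operatorname{Log} z,\quad z\in\mathcal A $$ (so $G(it)$ is defined for all real $t\ne 0$). The function $\rho$ on $(0,\infty)$ is defined by $$ \rho(t)=\begin{cases} -\dfrac{t\ln\left((1-t)/t^2\right)}{\ln(1-t)}, & 0<t<1,\\[2ex] -\dfrac{t\left(\ln\left((t-1)/t\right)\right)^2}{(\ln(t-1))^2+\pi^2}, & 1<t<\infty, \end{cases} $$ extended continuously by $\rho(1)=-1$; it is integrable over $(0,\infty)$. *)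

theory Defs
  imports "HOL-Analysis.Analysis"
begin

text \<open>
  \<^term>\<open>Ln\<close> agrees with the principal logarithm on the slit plane. The function is total here,
  but only its values on the slit plane are meaningful.
\<close>

definition G :: "complex \<Rightarrow> complex" where
  "G z = (1 - Ln z / Ln (1 + z)) * z * Ln z"

text \<open>The value 0 for \<^term>\<open>t \<le> (0::real)\<close> is a dummy, outside the domain of the function.\<close>

definition rho :: "real \<Rightarrow> real" where
  "rho t =
    (if 0 < t \<and> t < 1 then - (t * ln ((1 - t) / t\<^sup>2) / ln (1 - t))
     else if t = 1 then - 1
     else if 1 < t then - (t * (ln ((t - 1) / t))\<^sup>2 / ((ln (t - 1))\<^sup>2 + pi\<^sup>2))
     else 0)"

definition phi :: "real \<Rightarrow> real" where
  "phi s = (LINT t:{0<..}|lborel. exp (- (s * t)) * rho t)"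

definition square_integrable_on :: "(real \<Rightarrow> real) \<Rightarrow> real set \<Rightarrow> bool" where
  "square_integrable_on f A \<longleftrightarrow>
     set_borel_measurable lborel A f \<and> set_integrable lborel A (\<lambda>x. (f x)\<^sup>2)"

end

theory Submission
  imports Defs "HOL-Complex_Analysis.Complex_Analysis" "HOL-Real_Asymp.Real_Asymp"
begin

text \<open>
  The density \<^term>\<open>pi * rho t\<close> is the imaginary part of the boundary value of \<^const>\<open>G\<close> at
  \<^term>\<open>- t\<close> from above, so Cauchy's formula in the upper half plane represents \<^term>\<open>1 - G z\<close> as the
  Stieltjes integral of \<^term>\<open>rho t / (t + z)\<close>. Squaring this representation and integrating over the line with
  real part \<^term>\<open>a\<close> gives, by Fubini and Poisson kernels, the double integral of
  \<^term>\<open>rho t * rho u / (t + u + 2 * a)\<close>; no Plancherel theorem is needed, since squaring the Laplace transform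
  \<^const>\<open>phi\<close> gives the same form with \<^term>\<open>a = 0\<close>. Because \<^term>\<open>t + u \<ge> 2 * sqrt (t * u)\<close>, integrability of
  \<^term>\<open>rho t / sqrt t\<close> suffices both for Fubini and for the dominated limit in \<^term>\<open>a\<close>.
\<close>

section \<open>An integrable majorant on the real line\<close>

text \<open>
  The exponents are chosen such that this function is integrable and, multiplied by \<^term>\<open>sqrt r\<close>,
  still decays slowly enough to dominate \<^term>\<open>1 - G z\<close> on \<^term>\<open>norm z = r\<close>.
\<close>

definition majorant :: "real \<Rightarrow> real" where
  "majorant r = (if r \<le> 1 then r powr (-3/4) else r powr (-5/4))"

lemma majorant_nonneg: "0 \<le> majorant r"
  by (simp add: majorant_def)

lemma majorant_measurable [measurable]: "majorant \<in> borel_measurable borel"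
  unfolding majorant_def by measurable

text \<open>The two powers meet at 1, and beyond 1 the steeper one lies below the flatter one, so a
  comparison across the breakpoint passes through \<open>s powr (-3/4)\<close>.\<close>

lemma majorant_antimono:
  assumes "0 < r" "r \<le> s"
  shows "majorant s \<le> majorant r"
proof -
  have 1: "x powr (-3/4) \<le> r powr (-3/4)" if "r \<le> x" for x
    using assms that by (intro powr_mono2') auto
  have 2: "s powr (-5/4) \<le> s powr (-3/4)" if "1 < s"
    using that by (intro powr_mono) auto
  have 3: "s powr (-5/4) \<le> r powr (-5/4)"
    using assms by (intro powr_mono2') auto
  show ?thesis
    unfolding majorant_def
    using assms(2) 1[OF assms(2)] order_trans[OF 2 1[OF assms(2)]] 3 by (simp split: if_split)
qed

lemma integrable_majorant: "integrable lborel (\<lambda>x. majorant \<bar>x\<bar>)"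
proof -
  have a: "set_integrable lborel {0..1} (\<lambda>x::real. x powr (-3/4))"
  proof -
    have "(\<lambda>x::real. x powr (-3/4)) absolutely_integrable_on {0..1}"
      by (intro nonnegative_absolutely_integrable_1 integrable_on_powr_from_0) auto
    then show ?thesis
      by (simp add: set_integrable_def integrable_completion)
  qed
  have b: "set_integrable lborel {1..} (\<lambda>x::real. x powr (-5/4))"
  proof -
    have "(\<lambda>x::real. x powr (-5/4)) absolutely_integrable_on {1..}"
      using has_integral_powr_to_inf[of "-5/4" 1]
      by (intro nonnegative_absolutely_integrable_1) (auto simp: integrable_on_def)
    then show ?thesis
      by (simp add: set_integrable_def integrable_completion)
  qed
  let ?f = "\<lambda>x::real. indicator {0..1} x *\<^sub>R x powr (-3/4) + indicator {1..} x *\<^sub>R x powr (-5/4)"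
  have f: "integrable lborel ?f"
    using a b unfolding set_integrable_def by (rule Bochner_Integration.integrable_add)
  \<comment> \<open>\<open>?f\<close> lives on the positive half-line; its reflection supplies the
    negative one.\<close>
  have g: "integrable lborel (\<lambda>x. ?f x + ?f (-x))"
    using lborel_integrable_real_affine[OF f, of "-1" 0]
    by (intro Bochner_Integration.integrable_add[OF f]) simp
  show ?thesis
    by (rule Bochner_Integration.integrable_bound[OF g])
       (auto intro!: AE_I2 simp: majorant_def indicator_def)
qed

section \<open>Cauchy's formula, from rectangles to the upper half plane\<close>

lemma contour_integral_linepath_same_Im:
  assumes "a < b"
  shows "contour_integral (linepath (Complex a c) (Complex b c)) f =
         integral {a..b} (\<lambda>x. f (Complex x c))"
proof -
  have line: "linepath (Complex a c) (Complex b c) x = Complex (a + (b - a) * x) c" for x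
    by (simp add: linepath_def complex_eq_iff algebra_simps)
  have "contour_integral (linepath (Complex a c) (Complex b c)) f =
        (Complex b c - Complex a c) * integral {0..1} (\<lambda>x. f (Complex (a + (b - a) * x) c))"
    by (simp add: contour_integral_integral line)
  also have "Complex b c - Complex a c = of_real (b - a)"
    by (simp add: complex_eq_iff)
  also have "integral {0..1} (\<lambda>x. f (Complex (a + (b - a) * x) c)) =
             integral ((\<lambda>x. x / (b - a)) ` {0..b - a}) (\<lambda>x. f (Complex (a + (b - a) * x) c))"
    using assms by simp
  also have "\<dots> = (1 / (b - a)) *\<^sub>R integral {0..b - a} (\<lambda>x. f (Complex (a + x) c))"
    using integral_stretch_real[of "b - a" 0 "b - a" "\<lambda>x. f (Complex (a + x) c)"] assms
    by simp
  also have "integral {0..b - a} (\<lambda>x. f (Complex (a + x) c)) =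
             integral {a..b} (\<lambda>x. f (Complex x c))"
    using integral_shift_real_ivl[of a a b "\<lambda>x. f (Complex x c)"] by (simp add: add.commute)
  finally show ?thesis
    using assms by (simp add: scaleR_conv_of_real)
qed

text \<open>Only the bottom side becomes a real integral, because it will descend to the real axis;
  the other three sides are merely estimated.\<close>

lemma contour_integral_rectpath:
  assumes "a < b" "continuous_on (path_image (rectpath (Complex a c) (Complex b d))) f" "c \<le> d"
  shows "contour_integral (rectpath (Complex a c) (Complex b d)) f =
    integral {a..b} (\<lambda>x. f (Complex x c)) + contour_integral (linepath (Complex b c) (Complex b d)) f +
    contour_integral (linepath (Complex b d) (Complex a d)) f +
    contour_integral (linepath (Complex a d) (Complex a c)) f"
proof -
  let ?z = "\<lambda>x y. Complex x y"
  have "path_image (rectpath (?z a c) (?z b d)) = closed_segment (?z a c) (?z b c) \<union>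
      (closed_segment (?z b c) (?z b d) \<union> (closed_segment (?z b d) (?z a d) \<union> closed_segment (?z a d) (?z a c)))"
    by (simp add: rectpath_def Let_def path_image_join)
  with assms(2) have "f contour_integrable_on linepath (?z a c) (?z b c)"
    "f contour_integrable_on linepath (?z b c) (?z b d)"
    "f contour_integrable_on linepath (?z b d) (?z a d)"
    "f contour_integrable_on linepath (?z a d) (?z a c)"
    by (auto intro!: contour_integrable_continuous_linepath elim!: continuous_on_subset)
  then show ?thesis
    using assms(1) by (simp add: rectpath_def Let_def contour_integral_linepath_same_Im add.assoc)
qed

text \<open>
  The contour is the rectangle with corners \<^term>\<open>Complex (-R) e\<close> and \<^term>\<open>Complex R R\<close>; each of the three sides
  other than the bottom contributes at most \<^term>\<open>4 * B\<close>.
\<close>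

lemma rectangle_Cauchy_estimate:
  fixes F :: "complex \<Rightarrow> complex"
  assumes hol: "F holomorphic_on {w. 0 < Im w}"
    and bound: "\<And>w. R \<le> norm w \<Longrightarrow> 0 < Im w \<Longrightarrow> norm (F w) \<le> B"
    and e: "0 < e" "e < R" and z: "2 * norm z \<le> R" "Im z < 0 \<or> e < Im z"
  shows "norm (integral {-R..R} (\<lambda>x. F (Complex x e) / (Complex x e - z)) -
            (if 0 < Im z then 2 * pi * \<i> * F z else 0)) \<le> 12 * B"
proof -
  define g where "g = (\<lambda>w. F w / (w - z))"
  define I where "I = (if 0 < Im z then 2 * pi * \<i> * F z else 0)"
  let ?P = "rectpath (Complex (-R) e) (Complex R R)"
  have R: "0 < R"
    using e by simp
  have zR: "norm z < R"
    using z R by linarith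
  have P: "path_image ?P \<subseteq> {w. 0 < Im w} - {z}"
    using path_image_rectpath[of "Complex (-R) e" "Complex R R"] e zR abs_Re_le_cmod[of z] abs_Im_le_cmod[of z] z
    by auto
  have H: "convex {w. 0 < Im w}" "open {w. 0 < Im w}"
    by (auto simp: convex_halfspace_Im_gt open_halfspace_Im_gt)
  have "(g has_contour_integral I) ?P"
  \<comment> \<open>If \<open>z\<close> lies above the bottom side, it is enclosed once; otherwise
    \<open>Im z < 0\<close> and \<open>g\<close> is holomorphic on the whole half plane.\<close>
  proof (cases "0 < Im z")
    case True
    then have "winding_number ?P z = 1"
      using z zR abs_Re_le_cmod[of z] abs_Im_le_cmod[of z]
      by (intro winding_number_rectpath) (auto simp: in_box_complex_iff)
    with Cauchy_integral_formula_convex_simple[OF H(1) hol, of z ?P] True P H(2)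
    show ?thesis
      by (simp add: g_def I_def interior_open)
  next
    case False
    have "g holomorphic_on {w. 0 < Im w}"
      unfolding g_def using False by (intro holomorphic_intros hol) auto
    with Cauchy_theorem_convex_simple[OF _ H(1), of g ?P] P False show ?thesis
      by (simp add: I_def)
  qed
  then have "contour_integral ?P g = I"
    by (rule contour_integral_unique)
  moreover have contg: "continuous_on ({w. 0 < Im w} - {z}) g"
    unfolding g_def using holomorphic_on_imp_continuous_on[OF hol]
    by (intro continuous_intros) (auto elim: continuous_on_subset)
  ultimately have sum: "integral {-R..R} (\<lambda>x. g (Complex x e)) - I =
    - (contour_integral (linepath (Complex R e) (Complex R R)) g +
     contour_integral (linepath (Complex R R) (Complex (-R) R)) g +
     contour_integral (linepath (Complex (-R) R) (Complex (-R) e)) g)"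
    using contour_integral_rectpath[of "-R" R e R g] continuous_on_subset[OF contg P] R e
    by (simp add: algebra_simps add_eq_0_iff)
  have B: "0 \<le> B"
    using bound[of "Complex R R"] R order_trans[OF norm_ge_zero] abs_Re_le_cmod[of "Complex R R"] by auto
  \<comment> \<open>Since \<open>norm z\<close> is at most \<open>R / 2\<close>, the denominator is
    at least \<open>R / 2\<close> on these sides; length at most \<open>2 * R\<close> then yields
    the factor 4.\<close>
  have side: "norm (contour_integral (linepath u v) g) \<le> 4 * B"
    if S: "closed_segment u v \<subseteq> {w. 0 < Im w \<and> R \<le> norm w}" and "norm (v - u) \<le> 2 * R" for u v
  proof -
    have "norm (contour_integral (linepath u v) g) \<le> B / (R / 2) * norm (v - u)"
    proof (rule contour_integral_bound_linepath)
      show "g contour_integrable_on linepath u v"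
        using S zR by (intro contour_integrable_continuous_linepath continuous_on_subset[OF contg]) auto
      fix w assume "w \<in> closed_segment u v"
      then have w: "0 < Im w" "R \<le> norm w"
        using S by auto
      have "R / 2 \<le> norm (w - z)"
        using norm_triangle_ineq2[of w z] w z by linarith
      then show "norm (g w) \<le> B / (R / 2)"
        unfolding g_def norm_divide using bound[OF w(2,1)] B R
        by (intro frac_le) auto
    qed (use B R in auto)
    also have "\<dots> \<le> B / (R / 2) * (2 * R)"
      using that(2) B R by (intro mult_left_mono) auto
    finally show ?thesis
      using R by simp
  qed
  have far: "R \<le> norm w" if "R \<le> \<bar>Re w\<bar> \<or> R \<le> \<bar>Im w\<bar>" for w :: complex
    using that abs_Re_le_cmod[of w] abs_Im_le_cmod[of w] by linarith
  have "norm (contour_integral (linepath (Complex R e) (Complex R R)) g) \<le> 4 * B"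
    using e by (intro side) (auto simp: closed_segment_same_Re closed_segment_eq_real_ivl cmod_def intro!: far)
  moreover have "norm (contour_integral (linepath (Complex R R) (Complex (-R) R)) g) \<le> 4 * B"
    using e by (intro side) (auto simp: closed_segment_same_Im closed_segment_eq_real_ivl cmod_def real_sqrt_mult intro!: far)
  moreover have "norm (contour_integral (linepath (Complex (-R) R) (Complex (-R) e)) g) \<le> 4 * B"
    using e by (intro side) (auto simp: closed_segment_same_Re closed_segment_eq_real_ivl cmod_def intro!: far)
  ultimately have "norm (integral {-R..R} (\<lambda>x. g (Complex x e)) - I) \<le> 4 * B + 4 * B + 4 * B"
    unfolding sum norm_minus_cancel by (intro norm_triangle_mono)
  then show ?thesis
    by (simp add: I_def g_def)
qed

text \<open>The rectangle estimate is applied at height \<open>e k = 1 / R k\<close> with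
  \<open>R k\<close> tending to infinity. The far sides vanish because
  \<open>sqrt r * majorant r\<close> is \<open>r powr (-3/4)\<close> for \<open>r > 1\<close>, and
  on the bottom side \<open>majorant\<close> justifies dominated convergence. The case
  \<open>Im z < 0\<close> later removes the conjugate of the boundary value.\<close>

lemma upper_half_plane_Cauchy:
  fixes F :: "complex \<Rightarrow> complex"
  assumes hol: "F holomorphic_on {w. 0 < Im w}"
    and bound: "\<And>w. 0 < Im w \<Longrightarrow> norm (F w) \<le> C * (sqrt (norm w) * majorant (norm w))"
    and lim: "AE x in lborel. ((\<lambda>e. F (Complex x e)) \<longlongrightarrow> F (of_real x)) (at_right 0)"
    and meas [measurable]: "(\<lambda>x. F (of_real x)) \<in> borel_measurable borel"
    and z: "Im z \<noteq> 0"
  shows "integrable lborel (\<lambda>x. F (of_real x) / (of_real x - z))"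
    and "(LINT x|lborel. F (of_real x) / (of_real x - z)) = (if 0 < Im z then 2 * pi * \<i> * F z else 0)"
proof -
  define d where "d = \<bar>Im z\<bar> / 2"
  have d: "0 < d"
    using z by (simp add: d_def)
  \<comment> \<open>This start makes every \<open>R k\<close> at least 2, \<open>2 * norm z\<close>
    and \<open>1 / d\<close>, so the bottom sides stay at distance at least \<open>d\<close> from
    \<open>z\<close>.\<close>
  obtain K :: nat where K: "real K \<ge> 2 + 2 * norm z + 1 / d"
    using real_arch_simple by blast
  define R where "R = (\<lambda>k. real (k + K))"
  define e where "e = (\<lambda>k. 1 / R k)"
  have RK: "2 + 2 * norm z + 1 / d \<le> R k" for k
    using K by (simp add: R_def)
  have R2: "2 \<le> R k" "2 * norm z \<le> R k" "1 / d \<le> R k" for k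
    using RK[of k] d divide_pos_pos[OF zero_less_one d] norm_ge_zero[of z] by linarith+
  have e: "0 < e k" "e k < R k" "e k \<le> d" for k
  proof -
    show "0 < e k" using R2[of k] by (simp add: e_def)
    have "e k \<le> 1 / 2" unfolding e_def using R2(1)[of k] by (intro frac_le) auto
    then show "e k < R k" using R2(1)[of k] by linarith
    show "e k \<le> d" using R2(1,3)[of k] d by (simp add: e_def field_simps)
  qed
  have R_top: "filterlim R at_top sequentially"
    unfolding R_def using filterlim_tendsto_add_at_top[OF tendsto_const filterlim_real_sequentially, of "real K"]
    by (simp add: add.commute)
  have e_lim: "e \<longlonglongrightarrow> 0"
    unfolding e_def by (intro tendsto_divide_0[OF tendsto_const] filterlim_at_top_imp_at_infinity R_top)
  then have e_right: "filterlim e (at_right 0) sequentially"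
    using e(1) by (auto simp: filterlim_at less_imp_neq[THEN not_sym] intro!: always_eventually)
  define g where "g = (\<lambda>w. F w / (w - z))"
  have ne: "Complex x (e k) \<noteq> z" for x k
    using e(1,3)[of k] z by (auto simp: d_def)
  have g_cont: "continuous_on {-R k..R k} (\<lambda>x. g (Complex x (e k)))" for k
  proof -
    have "continuous_on {-R k..R k} (\<lambda>x. F (Complex x (e k)))"
      using e(1)[of k]
      by (intro continuous_on_compose2[OF holomorphic_on_imp_continuous_on[OF hol]] continuous_intros) auto
    then show ?thesis
      unfolding g_def using ne by (intro continuous_intros) auto
  qed
  define s where "s = (\<lambda>k x. indicator {-R k..R k} x *\<^sub>R g (Complex x (e k)))"
  have s_int: "integral\<^sup>L lborel (s k) = integral {-R k..R k} (\<lambda>x. g (Complex x (e k)))" for k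
  proof -
    have "set_integrable lborel {-R k..R k} (\<lambda>x. g (Complex x (e k)))"
      unfolding set_integrable_def by (rule borel_integrable_compact[OF _ g_cont]) simp
    from set_borel_integral_eq_integral(2)[OF this] show ?thesis
      by (simp add: s_def set_lebesgue_integral_def)
  qed
  have s_meas: "s k \<in> borel_measurable lborel" for k
    unfolding s_def using borel_measurable_continuous_on_indicator[OF _ g_cont, of k] by simp
  have C: "0 \<le> C"
    using order_trans[OF norm_ge_zero bound[of \<i>]] by (simp add: majorant_def)
  \<comment> \<open>\<open>A\<close> bounds \<open>sqrt (norm w) / norm (w - z)\<close> on all
    bottom sides: \<open>sqrt r\<close> is at most \<open>1 + r\<close>, and both 1 and
    \<open>norm w\<close> are controlled by \<open>norm (w - z)\<close>, which is at least
    \<open>d\<close>.\<close>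
  define A where "A = 1 / d + (1 + norm z / d)"
  have s_bound: "norm (s k x) \<le> C * A * majorant \<bar>x\<bar>" if "x \<noteq> 0" for k x
  proof -
    define w where "w = Complex x (e k)"
    have w: "0 < Im w" "\<bar>x\<bar> \<le> norm w"
      using e(1) abs_Re_le_cmod[of w] by (auto simp: w_def)
    have wz: "d \<le> norm (w - z)"
      using e(1,3)[of k] abs_Im_le_cmod[of "w - z"] by (auto simp: w_def d_def)
    have "norm w \<le> norm (w - z) + norm z"
      using norm_triangle_ineq[of "w - z" z] by simp
    also have "norm z \<le> norm z / d * norm (w - z)"
      using wz d mult_left_mono[OF wz, of "norm z"] by (simp add: field_simps)
    finally have 1: "norm w \<le> (1 + norm z / d) * norm (w - z)"
      by (simp add: algebra_simps)
    have 2: "1 \<le> 1 / d * norm (w - z)"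
      using wz d by (simp add: field_simps)
    have "sqrt (norm w) \<le> 1 + norm w"
      by (rule real_le_lsqrt) (auto simp: power2_eq_square algebra_simps)
    also have "\<dots> \<le> A * norm (w - z)"
      using 1 2 by (simp add: A_def algebra_simps)
    finally have 3: "sqrt (norm w) / norm (w - z) \<le> A"
      using wz d by (subst pos_divide_le_eq) auto
    have "norm (s k x) \<le> norm (F w) / norm (w - z)"
      by (simp add: s_def g_def w_def norm_divide indicator_def)
    also have "\<dots> \<le> C * (sqrt (norm w) * majorant (norm w)) / norm (w - z)"
      using bound[OF w(1)] by (rule divide_right_mono) simp
    also have "\<dots> = C * (sqrt (norm w) / norm (w - z)) * majorant (norm w)"
      by simp
    also have "\<dots> \<le> C * A * majorant \<bar>x\<bar>"
      using 3 C w(2) that d majorant_nonneg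
      by (intro mult_mono majorant_antimono mult_nonneg_nonneg) (auto simp: A_def)
    finally show ?thesis .
  qed
  have lim': "AE x in lborel. (\<lambda>k. s k x) \<longlonglongrightarrow> g (of_real x)"
    using lim
  proof eventually_elim
    case (elim x)
    have "(\<lambda>k. F (Complex x (e k))) \<longlonglongrightarrow> F (of_real x)"
      by (rule filterlim_compose[OF elim e_right])
    moreover have "(\<lambda>k. Complex x (e k) - z) \<longlonglongrightarrow> Complex x 0 - z"
      by (intro tendsto_intros e_lim)
    ultimately have "(\<lambda>k. g (Complex x (e k))) \<longlonglongrightarrow> g (of_real x)"
      unfolding g_def using z by (intro tendsto_divide) (auto simp: complex_of_real_def)
    moreover have "eventually (\<lambda>k. g (Complex x (e k)) = s k x) sequentially"
      using eventually_compose_filterlim[OF eventually_ge_at_top[of "\<bar>x\<bar>"] R_top]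
      by eventually_elim (auto simp: s_def indicator_def)
    ultimately show ?case
      by (rule Lim_transform_eventually)
  qed
  have dom: "integrable lborel (\<lambda>x. C * A * majorant \<bar>x\<bar>)"
    by (intro integrable_mult_right integrable_majorant)
  \<comment> \<open>The point 0 is left out because \<open>majorant 0 = 0\<close>.\<close>
  have AE0: "AE x in lborel. norm (s k x) \<le> C * A * majorant \<bar>x\<bar>" for k
    using AE_lborel_singleton[of 0] by eventually_elim (rule s_bound)
  have g_meas: "(\<lambda>x. g (of_real x)) \<in> borel_measurable lborel"
    unfolding g_def by measurable
  show "integrable lborel (\<lambda>x. F (of_real x) / (of_real x - z))"
    using integrable_dominated_convergence[OF g_meas s_meas dom lim' AE0] by (simp add: g_def)
  have lim1: "(\<lambda>k. integral\<^sup>L lborel (s k)) \<longlonglongrightarrow> (LINT x|lborel. g (of_real x))"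
    by (rule integral_dominated_convergence[OF g_meas s_meas dom lim' AE0])
  let ?I = "if 0 < Im z then 2 * pi * \<i> * F z else 0"
  have "norm (integral\<^sup>L lborel (s k) - ?I) \<le> 12 * (C * R k powr (-3/4))" for k
    unfolding s_int g_def
  proof (rule rectangle_Cauchy_estimate[OF hol _ e(1,2)])
    show "Im z < 0 \<or> e k < Im z"
      using e(3)[of k] z by (auto simp: d_def)
    fix w assume w: "R k \<le> norm w" "0 < Im w"
    then have r: "1 < norm w"
      using R2(1)[of k] by simp
    have "sqrt (norm w) * majorant (norm w) = norm w powr (1/2) * norm w powr (-5/4)"
      using r by (simp add: majorant_def powr_half_sqrt)
    also have "\<dots> = norm w powr (-3/4)"
      by (simp flip: powr_add)
    also have "\<dots> \<le> R k powr (-3/4)"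
      using w R2(1)[of k] by (intro powr_mono2') auto
    finally show "norm (F w) \<le> C * R k powr (-3/4)"
      by (rule order_trans[OF bound[OF w(2)] mult_left_mono[OF _ C]])
  qed (rule R2(2))
  then have "\<forall>\<^sub>F k in sequentially. norm (integral\<^sup>L lborel (s k) - ?I) \<le> 12 * (C * R k powr (-3/4))"
    by simp
  moreover have "(\<lambda>k. 12 * (C * R k powr (-3/4))) \<longlonglongrightarrow> 0"
    using tendsto_neg_powr[OF _ R_top, of "-3/4"] by (intro tendsto_mult_right_zero) simp
  ultimately have "(\<lambda>k. integral\<^sup>L lborel (s k) - ?I) \<longlonglongrightarrow> 0"
    by (rule Lim_null_comparison)
  then have "(\<lambda>k. integral\<^sup>L lborel (s k)) \<longlonglongrightarrow> ?I"
    by (rule LIM_zero_cancel)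
  with lim1 show "(LINT x|lborel. F (of_real x) / (of_real x - z)) = ?I"
    unfolding g_def by (rule LIMSEQ_unique)
qed

section \<open>Growth bounds for \<open>1 - G\<close> in the closed upper half plane\<close>

text \<open>Controls the quotient \<open>z / Ln (1 + z)\<close>, also where the logarithm vanishes.
  A logarithm of modulus at most \<open>c\<close> is handled through \<open>exp w - 1\<close>; a
  larger one exceeds \<open>norm z\<close> outright.\<close>

lemma norm_le_exp_mult_norm_Ln:
  assumes "norm z \<le> c" "1 + z \<noteq> 0"
  shows "norm z \<le> exp c * norm (Ln (1 + z))"
proof (cases "norm (Ln (1 + z)) \<le> c")
  case True
  have "norm z = norm (exp (Ln (1 + z)) - 1)"
    using assms(2) by simp
  also have "\<dots> \<le> exp \<bar>Re (Ln (1 + z))\<bar> * norm (Ln (1 + z))"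
    using Taylor_exp[of "Ln (1 + z)" 0] by simp
  also have "\<dots> \<le> exp c * norm (Ln (1 + z))"
    using True abs_Re_le_cmod[of "Ln (1 + z)"] by (intro mult_right_mono) auto
  finally show ?thesis .
next
  case False
  have "0 \<le> c"
    using assms(1) norm_ge_zero[of z] by linarith
  then have "1 * c \<le> exp c * norm (Ln (1 + z))"
    using False by (intro mult_mono) auto
  with assms(1) show ?thesis
    by simp
qed

lemma Ln_one_plus_nonzero:
  fixes z :: complex
  assumes "z \<noteq> 0" "z \<noteq> -1"
  shows "Ln (1 + z) \<noteq> 0"
proof
  assume "Ln (1 + z) = 0"
  moreover have "1 + z \<noteq> 0"
    using assms(2) by (auto simp: add_eq_0_iff)
  ultimately have "1 + z = 1"
    by (metis exp_Ln exp_zero)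
  with assms(1) show False
    by simp
qed

lemma norm_Ln_le_abs_ln:
  assumes "z \<noteq> 0"
  shows "norm (Ln z) \<le> \<bar>ln (norm z)\<bar> + 4"
  using cmod_le[of "Ln z"] assms mpi_less_Im_Ln[OF assms] Im_Ln_le_pi[OF assms] pi_less_4 by simp

text \<open>Expanding \<open>G z\<close> as \<open>z * ?L - z * ?L\<^sup>2 / ?M\<close> isolates
  \<open>z / ?M\<close>, the only quotient that needs care near 0.\<close>

lemma norm_one_minus_G_le_near:
  assumes "norm z \<le> c" "z \<noteq> 0" "z \<noteq> -1"
  shows "norm (1 - G z) \<le> 1 + norm z * norm (Ln z) + exp c * (norm (Ln z))\<^sup>2"
proof -
  let ?L = "Ln z" and ?M = "Ln (1 + z)"
  have M: "?M \<noteq> 0" "norm z / norm ?M \<le> exp c"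
    using Ln_one_plus_nonzero[OF assms(2,3)] norm_le_exp_mult_norm_Ln[of z c] assms
    by (auto simp: pos_divide_le_eq add_eq_0_iff)
  have "1 - G z = 1 - (z * ?L) + z * ?L\<^sup>2 / ?M"
    by (simp add: G_def algebra_simps power2_eq_square)
  then have "norm (1 - G z) \<le> 1 + norm (z * ?L) + norm (z * ?L\<^sup>2 / ?M)"
    by (metis norm_triangle_mono norm_triangle_ineq4 norm_one order_refl)
  also have "norm (z * ?L\<^sup>2 / ?M) = norm z / norm ?M * (norm ?L)\<^sup>2"
    by (simp add: norm_mult norm_divide norm_power)
  also have "\<dots> \<le> exp c * (norm ?L)\<^sup>2"
    by (intro mult_right_mono M) simp
  finally show ?thesis
    by (simp add: norm_mult)
qed

text \<open>The argument of \<open>z\<close> lies in [0, pi] and that of \<open>1 + 1 / z\<close> in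
  (-pi/2, 0], so their sum stays in the principal range.\<close>

lemma Ln_one_plus_eq:
  assumes "0 \<le> Im z" "1 < norm z"
  shows "Ln (1 + z) = Ln z + Ln (1 + 1 / z)"
proof -
  have z: "z \<noteq> 0"
    using assms by auto
  have "norm (1 / z) < 1"
    using assms(2) by (simp add: norm_divide divide_less_eq)
  then have re: "0 < Re (1 + 1 / z)"
    using abs_Re_le_cmod[of "1 / z"] by simp
  then have nz: "1 + 1 / z \<noteq> 0"
    by force
  have "Im (1 + 1 / z) \<le> 0"
    using assms(1) by (simp add: Im_divide field_simps)
  then have "-pi / 2 < Im (Ln (1 + 1 / z))" "Im (Ln (1 + 1 / z)) \<le> 0"
    using Re_Ln_pos_lt_imp[OF re] Im_Ln_pos_lt[OF nz] by auto
  moreover have "0 \<le> Im (Ln z)" "Im (Ln z) \<le> pi"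
    using Im_Ln_pos_le[OF z] assms(1) by auto
  moreover have "1 + z = z * (1 + 1 / z)"
    using z by (simp add: field_simps)
  ultimately show ?thesis
    using z nz pi_gt_zero Ln_times_simple[of z "1 + 1 / z"] by simp
qed

text \<open>Since \<open>?M - ?L = ?d\<close> and \<open>?d\<close> is close to
  \<open>1 / z\<close>, the main part of \<open>G z\<close> is \<open>z * ?d\<close>, and
  \<open>1 - G z\<close> becomes \<open>(1 - z * ?d) + z * ?d\<^sup>2 / ?M\<close>. Both terms are
  of order \<open>1 / norm z\<close>, the first by the second-order error of the logarithm.\<close>

lemma norm_one_minus_G_le_far:
  assumes "0 \<le> Im z" "4 \<le> norm z"
  shows "norm (1 - G z) \<le> 6 / norm z"
proof -
  let ?r = "norm z" and ?L = "Ln z" and ?M = "Ln (1 + z)" and ?d = "Ln (1 + 1 / z)"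
  have z: "z \<noteq> 0"
    using assms by auto
  have nz: "1 + z \<noteq> 0"
    using assms(2) norm_minus_cancel[of "1::complex"] by (force simp: add_eq_0_iff)
  have "3 \<le> norm (1 + z)"
    using norm_triangle_ineq2[of z "-1"] assms(2) by (simp add: add.commute)
  then have "exp 1 \<le> norm (1 + z)"
    using e_less_272 by simp
  then have "1 \<le> Re ?M"
    using nz by (simp add: ln_ge_iff)
  then have M: "1 \<le> norm ?M"
    using complex_Re_le_cmod[of ?M] by linarith
  have L_eq: "?L = ?M - ?d"
    using Ln_one_plus_eq[of z] assms by simp
  have "norm (?d - 1 / z) \<le> (norm (1 / z))\<^sup>2 / (1 - norm (1 / z))"
    using assms(2) by (intro Ln_approx_linear) (simp add: norm_divide divide_less_eq)
  also have "\<dots> = 1 / (?r * (?r - 1))"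
    using assms by (simp add: norm_divide field_simps power2_eq_square)
  also have "\<dots> \<le> 2 / (?r * ?r)"
    using assms by (simp add: divide_simps)
  finally have d1: "norm (?d - 1 / z) \<le> 2 / (?r * ?r)" .
  have "norm (1 - z * ?d) = ?r * norm (?d - 1 / z)"
    using z by (simp flip: norm_mult add: norm_minus_commute algebra_simps)
  also have "\<dots> \<le> ?r * (2 / (?r * ?r))"
    by (intro mult_left_mono d1) simp
  finally have 1: "norm (1 - z * ?d) \<le> 2 / ?r"
    using z by simp
  have "norm ?d \<le> 2 * norm (1 / z)"
    using assms by (intro norm_Ln_le) (simp add: norm_divide divide_simps)
  then have d2: "norm ?d \<le> 2 / ?r"
    by (simp add: norm_divide)
  have "norm (z * ?d\<^sup>2 / ?M) \<le> ?r * (2 / ?r)\<^sup>2 / 1"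
    unfolding norm_divide norm_mult norm_power
    using d2 M by (intro frac_le mult_mono power_mono) auto
  then have 2: "norm (z * ?d\<^sup>2 / ?M) \<le> 4 / ?r"
    using z by (simp add: power2_eq_square)
  have M0: "?M \<noteq> 0"
    using M by force
  then have "1 - (?M - ?d) / ?M = ?d / ?M"
    by (simp add: field_simps)
  then have "G z = z * ?d * ((?M - ?d) / ?M)"
    unfolding G_def L_eq by simp
  also have "(?M - ?d) / ?M = 1 - ?d / ?M"
    using M0 by (simp add: field_simps)
  finally have "1 - G z = (1 - z * ?d) + z * ?d\<^sup>2 / ?M"
    by (simp add: algebra_simps power2_eq_square)
  then have "norm (1 - G z) \<le> norm (1 - z * ?d) + norm (z * ?d\<^sup>2 / ?M)"
    by (metis norm_triangle_ineq)
  also have "\<dots> \<le> 2 / ?r + 4 / ?r"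
    by (intro add_mono 1 2)
  finally show ?thesis
    by (simp add: add_divide_distrib[symmetric])
qed

text \<open>A crude choice: \<open>exp 4\<close> comes from the near estimate with
  \<open>c = 4\<close>, and 500 is large enough for all ranges of \<open>norm z\<close>.\<close>

definition G_bound_const :: real where
  "G_bound_const = 500 * exp 4"

text \<open>Near 0 only the squared logarithm grows, between 1 and 4 boundedness suffices, and
  beyond 4 the decay \<open>1 / norm z\<close> is faster than the required power -3/4.\<close>

lemma norm_one_minus_G_le:
  assumes "0 \<le> Im z" "z \<noteq> 0" "z \<noteq> -1"
  shows "norm (1 - G z) \<le> G_bound_const * (sqrt (norm z) * majorant (norm z))"
proof -
  let ?r = "norm z"
  have r: "0 < ?r"
    using assms by simp
  have e4: "1 \<le> exp (4::real)"
    by simp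
  consider "?r \<le> 1" | "1 < ?r" "?r \<le> 4" | "4 < ?r"
    by linarith
  then show ?thesis
  proof cases
    case 1
    \<comment> \<open>The exponent makes \<open>q\<^sup>2\<close>, which absorbs the squared
      logarithm, exactly \<open>sqrt ?r * majorant ?r\<close>.\<close>
    define q where "q = ?r powr (-1/8)"
    have q: "1 \<le> q"
      using powr_mono2'[of "-1/8" ?r 1] r 1 by (simp add: q_def)
    have "\<bar>ln ?r\<bar> = ln (1 / ?r)"
      using r 1 by (simp add: ln_div)
    also have "\<dots> \<le> (1 / ?r) powr (1/8) / (1/8)"
      using r 1 by (intro ln_powr_bound) auto
    also have "(1 / ?r) powr (1/8) = q"
      using r by (simp add: q_def powr_divide powr_minus_divide)
    finally have "\<bar>ln ?r\<bar> \<le> 8 * q"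
      by simp
    then have L: "norm (Ln z) \<le> 12 * q"
      using norm_Ln_le_abs_ln[OF assms(2)] q by linarith
    have "norm (1 - G z) \<le> 1 + ?r * norm (Ln z) + exp 4 * (norm (Ln z))\<^sup>2"
      using 1 assms by (intro norm_one_minus_G_le_near) auto
    also have "\<dots> \<le> q\<^sup>2 + 1 * (12 * q) + exp 4 * (12 * q)\<^sup>2"
      using q 1 by (intro add_mono mult_mono mult_left_mono power_mono L) auto
    also have "\<dots> \<le> exp 4 * q\<^sup>2 + 12 * (exp 4 * q\<^sup>2) + exp 4 * (12 * q)\<^sup>2"
    proof -
      have a: "1 * q\<^sup>2 \<le> exp 4 * q\<^sup>2"
        using e4 by (intro mult_right_mono) auto
      have "q \<le> q\<^sup>2"
        using q by (intro self_le_power) auto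
      then show ?thesis
        using a by linarith
    qed
    also have "\<dots> \<le> G_bound_const * q\<^sup>2"
      by (simp add: G_bound_const_def power_mult_distrib)
    also have "q\<^sup>2 = sqrt ?r * majorant ?r"
      using r 1 by (simp add: q_def majorant_def power2_eq_square flip: powr_add powr_half_sqrt)
    finally show ?thesis .
  next
    case 2
    have "ln ?r \<le> ?r - 1"
      using r by (rule ln_le_minus_one)
    then have L: "norm (Ln z) \<le> 7"
      using norm_Ln_le_abs_ln[OF assms(2)] 2 by simp
    have "norm (1 - G z) \<le> 1 + ?r * norm (Ln z) + exp 4 * (norm (Ln z))\<^sup>2"
      using 2 assms by (intro norm_one_minus_G_le_near) auto
    also have "\<dots> \<le> 1 + 4 * 7 + exp 4 * 7\<^sup>2"
      using 2 by (intro add_mono mult_mono mult_left_mono power_mono L) auto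
    \<comment> \<open>The quarter is a lower bound of \<open>sqrt ?r * majorant ?r\<close> for
      \<open>?r\<close> between 1 and 4.\<close>
    also have "\<dots> \<le> G_bound_const * (1 / 4)"
      using e4 by (simp add: G_bound_const_def del: one_le_exp_iff)
    also have "\<dots> \<le> G_bound_const * (sqrt ?r * majorant ?r)"
    proof (intro mult_left_mono)
      have "1 / 4 = (4::real) powr (-1)"
        by simp
      also have "\<dots> \<le> 4 powr (-3/4)"
        by (intro powr_mono) auto
      also have "\<dots> \<le> ?r powr (-3/4)"
        using 2 by (intro powr_mono2') auto
      also have "\<dots> = sqrt ?r * majorant ?r"
        using r 2 by (simp add: majorant_def flip: powr_add powr_half_sqrt)
      finally show "1 / 4 \<le> sqrt ?r * majorant ?r" .
    qed (simp add: G_bound_const_def)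
    finally show ?thesis .
  next
    case 3
    have "norm (1 - G z) \<le> 6 / ?r"
      using 3 assms by (intro norm_one_minus_G_le_far) auto
    also have "\<dots> \<le> G_bound_const * ?r powr (-1)"
    proof -
      have "6 \<le> G_bound_const"
        unfolding G_bound_const_def using e4 by linarith
      then show ?thesis
        unfolding powr_minus_divide using r by (simp add: divide_right_mono)
    qed
    also have "\<dots> \<le> G_bound_const * ?r powr (-3/4)"
      using 3 by (intro mult_left_mono powr_mono) (auto simp: G_bound_const_def)
    also have "?r powr (-3/4) = sqrt ?r * majorant ?r"
      using r 3 by (simp add: majorant_def flip: powr_add powr_half_sqrt)
    finally show ?thesis .
  qed
qed

section \<open>Conjugation symmetry and boundary values of \<open>G\<close> on the real axis\<close>

lemma G_holomorphic: "G holomorphic_on {z. 0 < Im z}"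
  unfolding G_def
  by (intro holomorphic_intros) (auto simp: complex_nonpos_Reals_iff Ln_one_plus_nonzero)

lemma G_measurable [measurable]: "G \<in> borel_measurable borel"
  unfolding G_def by measurable

lemma G_cnj:
  assumes "Im z \<noteq> 0"
  shows "G (cnj z) = cnj (G z)"
proof -
  have "cnj (Ln w) = Ln (cnj w)" if "Im w \<noteq> 0" for w
    using that by (intro cnj_Ln) (auto simp: complex_nonpos_Reals_iff)
  from this[of z] this[of "1 + z"] show ?thesis
    using assms by (simp add: G_def)
qed

text \<open>For negative \<open>x\<close> the shift \<open>Ln w = Ln (- w) + \<i> * pi\<close> holds
  up to the cut from above, and \<open>- w\<close> stays near the positive axis, where
  \<open>Ln\<close> is continuous.\<close>

lemma tendsto_Ln_from_above:
  assumes "x \<noteq> 0"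
  shows "((\<lambda>e. Ln (Complex x e)) \<longlongrightarrow> Ln (of_real x)) (at_right 0)"
proof -
  have l: "((\<lambda>e. Complex x e) \<longlongrightarrow> of_real x) (at_right 0)"
    unfolding complex_of_real_def by (intro tendsto_intros)
  show ?thesis
  proof (cases "0 < x")
    case True
    then show ?thesis
      by (intro tendsto_Ln l) (auto simp: complex_nonpos_Reals_iff)
  next
    case False
    then have x: "x < 0"
      using assms by simp
    have *: "Ln (Complex x e) = Ln (- Complex x e) + \<i> * pi" if "0 \<le> e" for e
      using Ln_minus[of "Complex x e"] x that by (auto simp: complex_eq_iff)
    have "((\<lambda>e. Ln (- Complex x e) + \<i> * pi) \<longlongrightarrow> Ln (- of_real x) + \<i> * pi) (at_right 0)"
      using x by (intro tendsto_intros l) (auto simp: complex_nonpos_Reals_iff)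
    also have "Ln (- of_real x) + \<i> * pi = Ln (of_real x)"
      using *[of 0] by (simp add: complex_of_real_def)
    finally show ?thesis
      by (rule Lim_transform_eventually)
         (auto simp: eventually_at_right_less intro!: eventually_mono[OF eventually_at_right_less[of 0]] *[symmetric])
  qed
qed

lemma tendsto_G_from_above:
  assumes "x \<noteq> 0" "x \<noteq> -1"
  shows "((\<lambda>e. G (Complex x e)) \<longlongrightarrow> G (of_real x)) (at_right 0)"
proof -
  have 1: "1 + Complex x e = Complex (1 + x) e" for e
    by (simp add: complex_eq_iff)
  have 2: "((\<lambda>e. Ln (1 + Complex x e)) \<longlongrightarrow> Ln (1 + of_real x)) (at_right 0)"
    unfolding 1 using tendsto_Ln_from_above[of "1 + x"] assms by (simp add: add_eq_0_iff)
  have 3: "((\<lambda>e. Complex x e) \<longlongrightarrow> of_real x) (at_right 0)"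
    unfolding complex_of_real_def by (intro tendsto_intros)
  have "Ln (1 + of_real x) \<noteq> 0"
    using assms by (intro Ln_one_plus_nonzero) (auto simp: complex_eq_iff)
  then show ?thesis
    unfolding G_def by (intro tendsto_intros tendsto_Ln_from_above 2 3 assms) auto
qed

lemma Im_G_of_real_pos:
  assumes "0 < x"
  shows "Im (G (of_real x)) = 0"
proof -
  have "Ln (1 + of_real x) = of_real (ln (1 + x))"
    using Ln_of_real[of "1 + x"] assms by simp
  then have "G (of_real x) = of_real ((1 - ln x / ln (1 + x)) * x * ln x)"
    using assms by (simp add: G_def Ln_of_real)
  then show ?thesis
    by (metis Im_complex_of_real)
qed

lemma Ln_of_real_neg:
  assumes "0 < t"
  shows "Ln (- of_real t) = of_real (ln t) + \<i> * pi"
  using Ln_minus[of "of_real t"] assms by (simp add: Ln_of_real)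

text \<open>On the cut, \<^const>\<open>Ln\<close> takes its boundary values from above, hence so does \<^const>\<open>G\<close>.\<close>

lemma Im_G_of_real_neg:
  assumes "0 < t" "t \<noteq> 1"
  shows "Im (G (- of_real t)) = pi * rho t"
proof (cases "t < 1")
  case True
  \<comment> \<open>For \<open>t < 1\<close> this logarithm is real, so only the
    \<open>\<i> * pi\<close> in \<open>Ln (- of_real t)\<close> produces an imaginary part.\<close>
  have M: "Ln (1 + - of_real t) = of_real (ln (1 - t))"
    using Ln_of_real[of "1 - t"] True by simp
  have "ln ((1 - t) / t\<^sup>2) = ln (1 - t) - 2 * ln t"
    using True assms by (simp add: ln_div ln_realpow)
  then have r: "rho t = - (t * (ln (1 - t) - 2 * ln t) / ln (1 - t))"
    using True assms by (simp add: rho_def)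
  show ?thesis
    unfolding G_def M Ln_of_real_neg[OF assms(1)] r
    using True assms by (simp add: field_simps)
next
  case False
  define L M where "L = ln t" and "M = ln (t - 1)"
  have t: "1 < t"
    using False assms by simp
  have e: "1 + - of_real t = - complex_of_real (t - 1)"
    by simp
  have nz: "M\<^sup>2 + pi\<^sup>2 \<noteq> 0"
    using pi_gt_zero by (smt (verit) zero_le_power2 zero_less_power)
  define c where "c = of_real M + \<i> * pi"
  have c: "c \<noteq> 0"
    using pi_gt_zero by (auto simp: c_def complex_eq_iff)
  have "G (- of_real t) = (1 - (L + \<i> * pi) / c) * (- of_real t) * (L + \<i> * pi)"
    unfolding G_def e using t by (simp add: Ln_of_real_neg L_def M_def c_def del: of_real_diff)
  \<comment> \<open>The \<open>\<i> * pi\<close> of the two logarithms cancels in the difference,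
    which leaves the real factor \<open>M - L\<close>.\<close>
  also have "1 - (L + \<i> * pi) / c = of_real (M - L) / c"
    using c by (simp add: field_simps c_def)
  finally have "G (- of_real t) = of_real (- t * (M - L)) * ((L + \<i> * pi) / c)"
    by simp
  then have "Im (G (- of_real t)) = - t * (M - L) * Im ((L + \<i> * pi) / c)"
    by (simp only: times_complex.sel Re_complex_of_real Im_complex_of_real mult_zero_left add_0_right)
  also have "Im ((L + \<i> * pi) / c) = pi * (M - L) / (M\<^sup>2 + pi\<^sup>2)"
    by (simp add: c_def Im_divide algebra_simps diff_divide_distrib)
  also have "- t * (M - L) * (pi * (M - L) / (M\<^sup>2 + pi\<^sup>2)) = pi * rho t"
    using t by (simp add: rho_def ln_div L_def M_def power2_eq_square)
  finally show ?thesis .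
qed

section \<open>The Stieltjes representation of \<open>1 - G\<close> with density
  \<open>rho\<close>\<close>

lemma rho_measurable [measurable]: "rho \<in> borel_measurable borel"
  unfolding rho_def by measurable

lemma rho_nonpos: "t \<le> 0 \<Longrightarrow> rho t = 0"
  by (simp add: rho_def)

text \<open>Off \<open>t = 1\<close>, \<open>pi * rho t\<close> is the imaginary part of
  \<open>G (- of_real t)\<close>, so \<open>rho\<close> inherits the bound on
  \<open>1 - G\<close>.\<close>

lemma abs_rho_le:
  assumes "0 < t"
  shows "\<bar>rho t\<bar> \<le> G_bound_const * (sqrt t * majorant t)"
proof (cases "t = 1")
  case True
  have "1 \<le> exp (4::real)"
    by simp
  then have "1 \<le> G_bound_const"
    unfolding G_bound_const_def by linarith
  with True show ?thesis
    by (simp add: rho_def majorant_def)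
next
  case False
  have "\<bar>rho t\<bar> \<le> pi * \<bar>rho t\<bar>"
    using pi_gt3 mult_right_mono[of 1 pi "\<bar>rho t\<bar>"] by simp
  also have "\<dots> = \<bar>Im (1 - G (- of_real t))\<bar>"
    using Im_G_of_real_neg[OF assms False] by (simp add: abs_mult)
  also have "\<dots> \<le> norm (1 - G (- of_real t))"
    by (rule abs_Im_le_cmod)
  also have "\<dots> \<le> G_bound_const * (sqrt (norm (- complex_of_real t)) * majorant (norm (- complex_of_real t)))"
    using assms False by (intro norm_one_minus_G_le) (auto simp: complex_eq_iff)
  finally show ?thesis
    using assms by simp
qed

text \<open>Subtracting the conjugate of Cauchy's formula at \<open>cnj z\<close>, whose value is 0,
  from the formula at \<open>z\<close> replaces the boundary value \<open>F\<close> by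
  \<open>F - cnj F\<close>. This is \<open>- (2 * pi * \<i> * rho (- x))\<close> almost everywhere
  and vanishes for \<open>x > 0\<close>, where \<open>G\<close> is real.\<close>

lemma one_minus_G_Stieltjes:
  assumes "0 < Im z"
  shows "1 - G z = (LINT t|lborel. of_real (rho t) / (of_real t + z))"
proof -
  define F where "F = (\<lambda>w. 1 - G w)"
  have hol: "F holomorphic_on {w. 0 < Im w}"
    unfolding F_def by (intro holomorphic_intros G_holomorphic)
  have bound: "norm (F w) \<le> G_bound_const * (sqrt (norm w) * majorant (norm w))" if "0 < Im w" for w
    unfolding F_def using that by (intro norm_one_minus_G_le) auto
  have AE: "AE x in lborel. (x::real) \<noteq> 0 \<and> x \<noteq> -1"
    using AE_lborel_singleton[of "0::real"] AE_lborel_singleton[of "-1::real"] by eventually_elim simp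
  then have lim: "AE x in lborel. ((\<lambda>e. F (Complex x e)) \<longlongrightarrow> F (of_real x)) (at_right 0)"
    by eventually_elim (simp add: F_def tendsto_diff tendsto_G_from_above)
  have meas [measurable]: "(\<lambda>x. F (of_real x)) \<in> borel_measurable borel"
    unfolding F_def by measurable
  note Cauchy = upper_half_plane_Cauchy[OF hol bound lim meas]
  have up: "integrable lborel (\<lambda>x. F (of_real x) / (of_real x - z))"
    "(LINT x|lborel. F (of_real x) / (of_real x - z)) = 2 * pi * \<i> * F z"
    using Cauchy[of z] assms by auto
  have cnj_eq: "cnj (F (of_real x) / (of_real x - cnj z)) = cnj (F (of_real x)) / (of_real x - z)" for x
    by simp
  have low: "integrable lborel (\<lambda>x. cnj (F (of_real x)) / (of_real x - z))"
    "(LINT x|lborel. cnj (F (of_real x)) / (of_real x - z)) = 0"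
    using Cauchy[of "cnj z"] assms integrable_cnj[of lborel "\<lambda>x. F (of_real x) / (of_real x - cnj z)"]
      Bochner_Integration.integral_cnj[of lborel "\<lambda>x. F (of_real x) / (of_real x - cnj z)"]
    unfolding cnj_eq by auto
  have "2 * pi * \<i> * F z = (LINT x|lborel. F (of_real x) / (of_real x - z) - cnj (F (of_real x)) / (of_real x - z))"
    using up low by simp
  also have "\<dots> = (LINT x|lborel. 2 * pi * \<i> * (of_real (rho (- x)) / (of_real (- x) + z)))"
  proof (rule integral_cong_AE)
    show "AE x in lborel. F (of_real x) / (of_real x - z) - cnj (F (of_real x)) / (of_real x - z) =
        2 * pi * \<i> * (of_real (rho (- x)) / (of_real (- x) + z))"
      using AE
    proof eventually_elim
      case (elim x)
      have "Im (G (of_real x)) = pi * rho (- x)"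
      proof (cases "0 < x")
        case True
        then show ?thesis
          by (simp add: Im_G_of_real_pos rho_nonpos)
      next
        case False
        then show ?thesis
          using Im_G_of_real_neg[of "-x"] elim by simp
      qed
      then have "F (of_real x) - cnj (F (of_real x)) = - (2 * pi * \<i> * of_real (rho (- x)))"
        by (simp add: F_def complex_eq_iff)
      moreover have "of_real (- x) + z = - (of_real x - z)"
        by simp
      ultimately show ?case
        by (metis diff_divide_distrib minus_divide_divide minus_minus times_divide_eq_right)
    qed
    show "(\<lambda>x. F (of_real x) / (of_real x - z) - cnj (F (of_real x)) / (of_real x - z)) \<in> borel_measurable lborel"
      using up(1) low(1) by (intro borel_measurable_diff borel_measurable_integrable)
    show "(\<lambda>x. 2 * pi * \<i> * (of_real (rho (- x)) / (of_real (- x) + z))) \<in> borel_measurable lborel"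
      by measurable
  qed
  also have "\<dots> = 2 * pi * \<i> * (LINT x|lborel. of_real (rho (- x)) / (of_real (- x) + z))"
    by (rule integral_mult_right_zero)
  \<comment> \<open>The density sits on the negative axis; reflection moves it to positive
    \<open>t\<close>.\<close>
  also have "(LINT x|lborel. of_real (rho (- x)) / (of_real (- x) + z)) =
             (LINT t|lborel. of_real (rho t) / (of_real t + z))"
    using lborel_integral_real_affine[of "-1" "\<lambda>t. of_real (rho t) / (of_real t + z)" 0] by simp
  finally show ?thesis
    by (simp add: F_def)
qed

section \<open>Fubini for products and nonnegative kernels, and two kernel integrals\<close>

lemma (in pair_sigma_finite) has_bochner_integral_mult_pair:
  fixes f :: "'a \<Rightarrow> real" and g :: "'b \<Rightarrow> real"
  assumes f: "integrable M1 f" and g: "integrable M2 g"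
  shows "has_bochner_integral (M1 \<Otimes>\<^sub>M M2) (\<lambda>(x, y). f x * g y) (integral\<^sup>L M1 f * integral\<^sup>L M2 g)"
proof -
  have [measurable]: "f \<in> borel_measurable M1" "g \<in> borel_measurable M2"
    using f g by auto
  have int: "integrable (M1 \<Otimes>\<^sub>M M2) (\<lambda>(x, y). f x * g y)"
  proof (rule Fubini_integrable)
    show "integrable M1 (\<lambda>x. \<integral>y. norm (case (x, y) of (x, y) \<Rightarrow> f x * g y) \<partial>M2)"
      using f g by (simp add: abs_mult)
    show "AE x in M1. integrable M2 (\<lambda>y. case (x, y) of (x, y) \<Rightarrow> f x * g y)"
      using g by simp
  qed measurable
  then show ?thesis
    using integral_fst[OF int] by (simp add: has_bochner_integral_iff)
qed

text \<open>Nonnegativity of the kernel makes the iterated integral absolutely convergent.\<close>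

lemma (in pair_sigma_finite) has_bochner_integral_nonneg_kernel:
  fixes r :: "'b \<Rightarrow> real" and K :: "'a \<Rightarrow> 'b \<Rightarrow> real"
  assumes meas [measurable]: "(\<lambda>(y, p). r p * K y p) \<in> borel_measurable (M1 \<Otimes>\<^sub>M M2)"
    and K: "\<And>y p. r p \<noteq> 0 \<Longrightarrow> 0 \<le> K y p"
    and k: "\<And>p. r p \<noteq> 0 \<Longrightarrow> has_bochner_integral M1 (\<lambda>y. K y p) (k p)"
    and int: "integrable M2 (\<lambda>p. r p * k p)"
  shows "has_bochner_integral M1 (\<lambda>y. \<integral>p. r p * K y p \<partial>M2) (\<integral>p. r p * k p \<partial>M2)"
proof -
  \<comment> \<open>Where \<open>r p\<close> vanishes the product is 0, so the kernel matters only
    on the support of \<open>r\<close>, which lies in the positive quadrant in the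
    applications.\<close>
  have rk: "has_bochner_integral M1 (\<lambda>y. r p * K y p) (r p * k p)" for p
    by (cases "r p = 0") (auto intro: has_bochner_integral_mult_right k has_bochner_integral_zero)
  have abs: "has_bochner_integral M1 (\<lambda>y. \<bar>r p * K y p\<bar>) \<bar>r p * k p\<bar>" for p
  proof (cases "r p = 0")
    case False
    have "0 \<le> k p"
      unfolding has_bochner_integral_integral_eq[OF k[OF False], symmetric]
      using K[OF False] by (intro Bochner_Integration.integral_nonneg)
    then show ?thesis
      using has_bochner_integral_mult_right[OF k[OF False], of "\<bar>r p\<bar>"] K[OF False] by (simp add: abs_mult)
  qed (auto intro: has_bochner_integral_zero)
  \<comment> \<open>Integrability on the product is tested by integrating over \<open>y\<close>
    first, hence the swapped pair.\<close>
  interpret Q: pair_sigma_finite M2 M1 ..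
  have "integrable (M2 \<Otimes>\<^sub>M M1) (\<lambda>(p, y). r p * K y p)"
  proof (rule Q.Fubini_integrable)
    show "(\<lambda>(p, y). r p * K y p) \<in> borel_measurable (M2 \<Otimes>\<^sub>M M1)"
      using measurable_compose[OF measurable_pair_swap' meas] by (simp add: case_prod_beta)
    show "integrable M2 (\<lambda>p. \<integral>y. norm (case (p, y) of (p, y) \<Rightarrow> r p * K y p) \<partial>M1)"
      using integrable_abs[OF int] by (simp add: has_bochner_integral_integral_eq[OF abs])
    show "AE p in M2. integrable M1 (\<lambda>y. case (p, y) of (p, y) \<Rightarrow> r p * K y p)"
      using rk by (auto simp: has_bochner_integral_iff)
  qed
  then show ?thesis
    using Q.integrable_snd[of "\<lambda>p y. r p * K y p"] Q.Fubini_integral[of "\<lambda>p y. r p * K y p"]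
    by (simp only: has_bochner_integral_iff has_bochner_integral_integral_eq[OF rk])
qed

lemma has_bochner_integral_Poisson_kernel:
  fixes p :: real
  assumes p: "0 < p"
  shows "has_bochner_integral lborel (\<lambda>y. p / (p\<^sup>2 + y\<^sup>2)) pi"
proof -
  let ?F = "\<lambda>y. arctan (y / p)" and ?f = "\<lambda>y. p / (p\<^sup>2 + y\<^sup>2)"
  have nz: "p\<^sup>2 + y\<^sup>2 \<noteq> 0" for y
    using p by (simp add: add_nonneg_eq_0_iff)
  have F: "(?F has_real_derivative ?f y) (at y)" for y
    using p nz by (auto intro!: derivative_eq_intros simp: field_simps power2_eq_square)
  have top: "(?F \<longlongrightarrow> pi / 2) at_top" and bot: "(?F \<longlongrightarrow> - (pi / 2)) at_bot"
    using p by real_asymp+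
  have FTC: "set_integrable lborel (einterval (-\<infinity>) \<infinity>) ?f" "(LBINT y=-\<infinity>..\<infinity>. ?f y) = pi / 2 - - (pi / 2)"
    using interval_integral_FTC_nonneg[of "-\<infinity>" \<infinity> ?F ?f "- (pi / 2)" "pi / 2"] F nz p top bot
    by (simp_all add: ereal_tendsto_simps)
  then show ?thesis
    by (simp add: has_bochner_integral_iff set_integrable_def interval_lebesgue_integral_def
        set_lebesgue_integral_def einterval_eq_UNIV)
qed

lemma has_bochner_integral_exp_atLeast:
  fixes c :: real
  assumes "0 < c"
  shows "has_bochner_integral lborel (\<lambda>s. indicator {0..} s * exp (- (s * c))) (1 / c)"
proof (rule has_bochner_integral_nn_integral)
  have lim: "((\<lambda>s. - exp (- (s * c)) / c) \<longlongrightarrow> 0) at_top"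
    using assms by real_asymp
  have "(\<integral>\<^sup>+s. ennreal (exp (- (s * c))) * indicator {0..} s \<partial>lborel) = ennreal (0 - (- exp (- (0 * c)) / c))"
    using assms by (intro nn_integral_FTC_atLeast lim) (auto intro!: derivative_eq_intros)
  then show "(\<integral>\<^sup>+s. ennreal (indicator {0..} s * exp (- (s * c))) \<partial>lborel) = ennreal (1 / c)"
    by (simp add: ennreal_mult' ennreal_indicator mult.commute)
qed (use assms in auto)

section \<open>Weighted integrability of \<open>rho\<close> and the quadratic form\<close>

text \<open>The bound on \<open>rho\<close> carries a factor \<open>sqrt t\<close>; a weight that
  compensates it leaves \<open>majorant\<close>. This criterion serves all weights below.\<close>

lemma integrable_rho_mult:
  fixes w :: "real \<Rightarrow> real"
  assumes [measurable]: "w \<in> borel_measurable borel"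
    and w: "\<And>t. 0 < t \<Longrightarrow> sqrt t * \<bar>w t\<bar> \<le> c"
  shows "integrable lborel (\<lambda>t. rho t * w t)"
proof (rule Bochner_Integration.integrable_bound)
  show "integrable lborel (\<lambda>t. G_bound_const * c * majorant \<bar>t\<bar>)"
    by (intro integrable_mult_right integrable_majorant)
  have "norm (rho t * w t) \<le> norm (G_bound_const * c * majorant \<bar>t\<bar>)" for t
  proof (cases "0 < t")
    case True
    have "\<bar>rho t * w t\<bar> \<le> G_bound_const * (sqrt t * majorant t) * \<bar>w t\<bar>"
      unfolding abs_mult by (intro mult_right_mono abs_rho_le True) simp
    also have "\<dots> = G_bound_const * (sqrt t * \<bar>w t\<bar>) * majorant t"
      by simp
    also have "\<dots> \<le> G_bound_const * c * majorant t"
      by (intro mult_right_mono mult_left_mono w True majorant_nonneg) (simp add: G_bound_const_def)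
    finally show ?thesis
      using True by simp
  qed (simp add: rho_nonpos)
  then show "AE t in lborel. norm (rho t * w t) \<le> norm (G_bound_const * c * majorant \<bar>t\<bar>)"
    by simp
qed measurable

abbreviation rho_pair :: "real \<times> real \<Rightarrow> real" where
  "rho_pair p \<equiv> rho (fst p) * rho (snd p)"

text \<open>The common value of the integrals in the theorem. As \<open>rho\<close> vanishes on
  nonpositive arguments, only the open quadrant contributes, where the denominator is positive for
  \<open>a \<ge> 0\<close>.\<close>

definition rho_form :: "real \<Rightarrow> real" where
  "rho_form a = (LINT p|lborel. rho_pair p * (1 / (fst p + snd p + 2 * a)))"

lemma fst_snd_borel_measurable [measurable]:
  "fst \<in> borel_measurable (borel :: (real \<times> real) measure)"
  "snd \<in> borel_measurable (borel :: (real \<times> real) measure)"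
  by (auto intro!: borel_measurable_continuous_onI continuous_intros)

lemma rho_pair_nonzero:
  assumes "rho_pair p \<noteq> 0"
  shows "0 < fst p" "0 < snd p"
  using assms rho_nonpos[of "fst p"] rho_nonpos[of "snd p"] by (auto simp: not_le[symmetric])

lemma has_bochner_integral_rho_pair_square:
  fixes w :: "real \<Rightarrow> real"
  assumes "integrable lborel (\<lambda>t. rho t * w t)"
  shows "has_bochner_integral lborel (\<lambda>p. rho_pair p * (w (fst p) * w (snd p)))
           ((LINT t|lborel. rho t * w t)\<^sup>2)"
  using lborel_pair.has_bochner_integral_mult_pair[OF assms assms]
  by (simp add: lborel_prod case_prod_unfold power2_eq_square mult_ac)

text \<open>Free of \<open>a\<close>, so that one function dominates the form for all
  \<open>a \<ge> 0\<close>; its product shape reduces integrability to one variable.\<close>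

definition rho_form_bound :: "real \<times> real \<Rightarrow> real" where
  "rho_form_bound p = \<bar>rho_pair p * (1 / sqrt (fst p) * (1 / sqrt (snd p)))\<bar>"

lemma integrable_rho_form_bound: "integrable lborel rho_form_bound"
proof -
  have "integrable lborel (\<lambda>t. rho t * (1 / sqrt t))"
    by (rule integrable_rho_mult[where c = 1]) auto
  from has_bochner_integral_rho_pair_square[OF this] show ?thesis
    unfolding rho_form_bound_def by (intro integrable_abs) (auto simp: has_bochner_integral_iff)
qed

lemma rho_form_integrand_le:
  assumes "0 \<le> a"
  shows "norm (rho_pair p * (1 / (fst p + snd p + 2 * a))) \<le> rho_form_bound p"
proof (cases "rho_pair p = 0")
  case False
  define t u where "t = fst p" and "u = snd p"
  have tu: "0 < t" "0 < u"
    using rho_pair_nonzero[OF False] by (auto simp: t_def u_def)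
  have "2 * (sqrt t * sqrt u) \<le> t + u"
    using tu arith_geo_mean_sqrt[of t u] by (simp add: real_sqrt_mult)
  moreover have "0 < sqrt t * sqrt u"
    using tu by simp
  ultimately have "1 / (t + u + 2 * a) \<le> 1 / (sqrt t * sqrt u)"
    using assms by (intro frac_le) auto
  then have "\<bar>rho_pair p\<bar> * (1 / (t + u + 2 * a)) \<le> \<bar>rho_pair p\<bar> * (1 / (sqrt t * sqrt u))"
    by (rule mult_left_mono) simp
  then show ?thesis
    using tu assms by (simp add: rho_form_bound_def abs_mult t_def u_def)
qed (auto simp: rho_form_bound_def)

lemma integrable_rho_form:
  assumes "0 \<le> a"
  shows "integrable lborel (\<lambda>p. rho_pair p * (1 / (fst p + snd p + 2 * a)))"
proof (rule Bochner_Integration.integrable_bound[OF integrable_rho_form_bound])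
  show "AE p in lborel. norm (rho_pair p * (1 / (fst p + snd p + 2 * a))) \<le> norm (rho_form_bound p)"
    using order_trans[OF rho_form_integrand_le[OF assms] abs_ge_self] by simp
qed measurable

lemma tendsto_rho_form: "(rho_form \<longlongrightarrow> rho_form 0) (at_right 0)"
\<comment> \<open>Dominated convergence concerns sequences; \<open>1\<close> is an arbitrary right
  end of a one-sided neighbourhood of 0.\<close>
proof (rule tendsto_at_right_sequentially[of _ 1])
  fix S :: "nat \<Rightarrow> real"
  assume S: "\<And>n. 0 < S n" "S \<longlonglongrightarrow> 0"
  show "(\<lambda>n. rho_form (S n)) \<longlonglongrightarrow> rho_form 0"
    unfolding rho_form_def
  proof (rule integral_dominated_convergence[OF _ _ integrable_rho_form_bound])
    show "AE p in lborel. norm (rho_pair p * (1 / (fst p + snd p + 2 * S n))) \<le> rho_form_bound p" for n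
      using rho_form_integrand_le[of "S n"] S(1)[of n] by simp
    have "(\<lambda>n. rho_pair p * (1 / (fst p + snd p + 2 * S n))) \<longlonglongrightarrow> rho_pair p * (1 / (fst p + snd p + 2 * 0))" for p
    proof (cases "rho_pair p = 0")
      case False
      then show ?thesis
        using rho_pair_nonzero[OF False] by (intro tendsto_intros S(2)) auto
    qed auto
    then show "AE p in lborel. (\<lambda>n. rho_pair p * (1 / (fst p + snd p + 2 * S n)))
        \<longlonglongrightarrow> rho_pair p * (1 / (fst p + snd p + 2 * 0))"
      by simp
  qed measurable
qed auto

section \<open>The square of the Laplace transform\<close>

lemma integrable_rho_exp:
  assumes "0 < s"
  shows "integrable lborel (\<lambda>t. rho t * exp (- (s * t)))"
proof (rule integrable_rho_mult)
  fix t :: real assume t: "0 < t"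
  have "sqrt t \<le> 1 + t"
    using t by (intro real_le_lsqrt) (auto simp: power2_eq_square algebra_simps)
  \<comment> \<open>The factor \<open>1 + 1 / s\<close> trades \<open>1 + t\<close> for
    \<open>1 + s * t\<close>, which the exponential absorbs.\<close>
  also have "\<dots> \<le> (1 + 1 / s) * (1 + s * t)"
    using assms t by (simp add: field_simps)
  also have "\<dots> \<le> (1 + 1 / s) * exp (s * t)"
    using assms by (intro mult_left_mono exp_ge_add_one_self) auto
  finally show "sqrt t * \<bar>exp (- (s * t))\<bar> \<le> 1 + 1 / s"
    by (simp add: exp_minus field_simps)
qed measurable

lemma phi_eq: "phi s = (LINT t|lborel. rho t * exp (- (s * t)))"
  unfolding phi_def set_lebesgue_integral_def
  by (intro Bochner_Integration.integral_cong) (auto simp: indicator_def rho_nonpos mult.commute not_less)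

lemma phi_measurable [measurable]: "phi \<in> borel_measurable borel"
  unfolding phi_eq[abs_def] by measurable

text \<open>For \<open>s > 0\<close> the square of \<open>phi s\<close> is a double integral with
  kernel \<open>exp (- (s * (t + u)))\<close>, whose integral over \<open>s\<close> is
  \<open>1 / (t + u)\<close>.\<close>

lemma has_bochner_integral_phi_square:
  "has_bochner_integral lborel (\<lambda>s. indicator {0..} s * (phi s)\<^sup>2) (rho_form 0)"
proof -
  define K where "K = (\<lambda>s p. indicator {0..} s * exp (- (s * (fst p + snd p + 2 * 0))) :: real)"
  have I: "has_bochner_integral lborel (\<lambda>s. LINT p|lborel. rho_pair p * K s p) (rho_form 0)"
    unfolding rho_form_def
  proof (rule lborel_pair.has_bochner_integral_nonneg_kernel)
    show "(\<lambda>(s, p). rho_pair p * K s p) \<in> borel_measurable (lborel \<Otimes>\<^sub>M lborel)"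
      unfolding K_def by measurable
    show "has_bochner_integral lborel (\<lambda>s. K s p) (1 / (fst p + snd p + 2 * 0))" if "rho_pair p \<noteq> 0" for p
      unfolding K_def using rho_pair_nonzero[OF that] by (intro has_bochner_integral_exp_atLeast) simp
  qed (auto simp: K_def integrable_rho_form[of 0, simplified])
  \<comment> \<open>The product identity is available for positive \<open>s\<close>; for negative
    \<open>s\<close> both sides are 0, and 0 is a null set.\<close>
  have eq: "AE s in lborel. (LINT p|lborel. rho_pair p * K s p) = indicator {0..} s * (phi s)\<^sup>2"
    using AE_lborel_singleton[of "0::real"]
  proof eventually_elim
    case (elim s)
    show ?case
    proof (cases "0 < s")
      case True
      then have "K s p = exp (- (s * fst p)) * exp (- (s * snd p))" for p
        by (simp add: K_def algebra_simps flip: exp_add)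
      with True has_bochner_integral_rho_pair_square[OF integrable_rho_exp[OF True]] show ?thesis
        by (simp add: has_bochner_integral_iff phi_eq)
    qed (use elim in \<open>simp add: K_def\<close>)
  qed
  show ?thesis
    by (rule has_bochner_integral_cong_AE[THEN iffD1, OF borel_measurable_has_bochner_integral[OF I] _ eq I]) measurable
qed

section \<open>The mean square of \<open>1 - G\<close> on vertical lines\<close>

text \<open>Vertical lines meet both half planes; as \<open>rho\<close> is real, conjugation carries
  the representation to the lower one.\<close>

lemma one_minus_G_Stieltjes_off_axis:
  assumes "Im z \<noteq> 0"
  shows "1 - G z = (LINT t|lborel. of_real (rho t) / (of_real t + z))"
proof (cases "0 < Im z")
  case False
  then have "1 - G z = cnj (1 - G (cnj z))"
    using assms G_cnj[of z] by simp
  also have "\<dots> = cnj (LINT t|lborel. of_real (rho t) / (of_real t + cnj z))"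
    using False assms by (subst one_minus_G_Stieltjes) auto
  also have "\<dots> = (LINT t|lborel. of_real (rho t) / (of_real t + z))"
    by (simp flip: Bochner_Integration.integral_cnj)
  finally show ?thesis .
qed (rule one_minus_G_Stieltjes)

text \<open>The reciprocal of \<open>t + a + \<i> * y\<close> is
  \<open>\<alpha> t - \<i> * \<beta> t\<close>, so the Stieltjes integral has real part
  \<open>A\<close> and imaginary part \<open>- B\<close>, and each square is a double
  integral.\<close>

lemma norm_one_minus_G_square:
  assumes a: "0 \<le> a" and y: "y \<noteq> 0"
  defines "\<alpha> \<equiv> \<lambda>t. (t + a) / ((t + a)\<^sup>2 + y\<^sup>2)" and "\<beta> \<equiv> \<lambda>t. y / ((t + a)\<^sup>2 + y\<^sup>2)"
  shows "(norm (1 - G (Complex a y)))\<^sup>2 =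
    (LINT p|lborel. rho_pair p * (\<alpha> (fst p) * \<alpha> (snd p) + \<beta> (fst p) * \<beta> (snd p)))"
proof -
  \<comment> \<open>Both weights are at most \<open>1 / \<bar>y\<bar>\<close> and at most
    \<open>1 / t\<close>; the first bound serves \<open>t \<le> 1\<close>, the second
    \<open>t > 1\<close>.\<close>
  have bounds: "sqrt t * \<bar>\<alpha> t\<bar> \<le> 1 + 1 / \<bar>y\<bar>" "sqrt t * \<bar>\<beta> t\<bar> \<le> 1 + 1 / \<bar>y\<bar>" if t: "0 < t" for t
  proof -
    define p where "p = t + a"
    have p: "t \<le> p" "0 < p"
      using t a by (auto simp: p_def)
    have "2 * (\<bar>y\<bar> * p) \<le> p\<^sup>2 + y\<^sup>2" "0 \<le> \<bar>y\<bar> * p"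
      using sum_squares_bound[of p "\<bar>y\<bar>"] p by (simp_all add: mult_ac)
    then have amgm: "\<bar>y\<bar> * p \<le> p\<^sup>2 + y\<^sup>2"
      by linarith
    have pos: "0 < p\<^sup>2 + y\<^sup>2"
      using p by (simp add: add_pos_nonneg)
    have "\<bar>\<alpha> t\<bar> \<le> 1 / \<bar>y\<bar>" "\<bar>\<beta> t\<bar> \<le> 1 / \<bar>y\<bar>" "\<bar>\<alpha> t\<bar> \<le> 1 / p" "\<bar>\<beta> t\<bar> \<le> 1 / p"
      unfolding \<alpha>_def \<beta>_def p_def[symmetric]
      using p y pos amgm by (auto simp: abs_mult divide_simps power2_eq_square mult.commute)
    moreover have "1 / p \<le> 1 / t"
      using p t by (intro frac_le) auto
    moreover have "sqrt t * x \<le> 1 + 1 / \<bar>y\<bar>" if x: "x \<le> 1 / \<bar>y\<bar>" "x \<le> 1 / t" "0 \<le> x" for x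
    proof (cases "t \<le> 1")
      case True
      then have "sqrt t * x \<le> 1 * (1 / \<bar>y\<bar>)"
        using x t by (intro mult_mono) auto
      then show ?thesis
        by simp
    next
      case False
      then have "sqrt t \<le> t"
        using t by (intro real_le_lsqrt) (auto simp: power2_eq_square)
      then have "sqrt t * x \<le> t * (1 / t)"
        using x t by (intro mult_mono) auto
      then show ?thesis
        using t by (simp add: add_increasing2)
    qed
    ultimately show "sqrt t * \<bar>\<alpha> t\<bar> \<le> 1 + 1 / \<bar>y\<bar>" "sqrt t * \<bar>\<beta> t\<bar> \<le> 1 + 1 / \<bar>y\<bar>"
      by (meson abs_ge_zero order_trans)+
  qed
  have int_\<alpha>: "integrable lborel (\<lambda>t. rho t * \<alpha> t)"
    by (rule integrable_rho_mult[OF _ bounds(1)]) (auto simp: \<alpha>_def)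
  have int_\<beta>: "integrable lborel (\<lambda>t. rho t * \<beta> t)"
    by (rule integrable_rho_mult[OF _ bounds(2)]) (auto simp: \<beta>_def)
  define A B where "A = (LINT t|lborel. rho t * \<alpha> t)" and "B = (LINT t|lborel. rho t * \<beta> t)"
  have split: "of_real (rho t) / (of_real t + Complex a y) = of_real (rho t * \<alpha> t) - \<i> * of_real (rho t * \<beta> t)" for t
  proof -
    have "(t + a)\<^sup>2 + y\<^sup>2 \<noteq> 0"
      using y by (simp add: sum_power2_eq_zero_iff)
    then show ?thesis
      by (simp add: complex_eq_iff Re_divide Im_divide \<alpha>_def \<beta>_def power2_eq_square[of "(t + a)\<^sup>2 + y\<^sup>2"])
  qed
  have S: "(LINT t|lborel. of_real (rho t) / (of_real t + Complex a y)) = of_real A - \<i> * of_real B"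
    unfolding split A_def B_def using int_\<alpha> int_\<beta>
    by (subst Bochner_Integration.integral_diff)
       (auto simp only: integral_mult_right_zero integral_complex_of_real integrable_mult_right integrable_of_real)
  have "(norm (1 - G (Complex a y)))\<^sup>2 = A\<^sup>2 + B\<^sup>2"
    using S y by (simp add: one_minus_G_Stieltjes_off_axis cmod_power2)
  also have "\<dots> = (LINT p|lborel. rho_pair p * (\<alpha> (fst p) * \<alpha> (snd p)) + rho_pair p * (\<beta> (fst p) * \<beta> (snd p)))"
    using has_bochner_integral_add[OF has_bochner_integral_rho_pair_square[OF int_\<alpha>]
        has_bochner_integral_rho_pair_square[OF int_\<beta>]]
    by (simp add: has_bochner_integral_iff A_def B_def)
  finally show ?thesis
    by (simp add: distrib_left)
qed

text \<open>On the support of \<open>rho_pair\<close> the kernel is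
  \<open>(P y u + P y v) / (2 * pi * (u + v))\<close>. Each Poisson kernel integrates to
  \<open>pi\<close>, which leaves \<open>1 / (u + v)\<close>. The finite value includes square
  integrability of \<open>1 - G\<close> on the line.\<close>

lemma nn_integral_one_minus_G_square:
  assumes a: "0 \<le> a"
  shows "(\<integral>\<^sup>+ y. ennreal ((norm (1 - G (Complex a y)))\<^sup>2 / (2 * pi)) \<partial>lborel) = ennreal (rho_form a)"
proof -
  define P where "P = (\<lambda>y x :: real. x / (x\<^sup>2 + y\<^sup>2))"
  define K where "K = (\<lambda>y p. (P y (fst p + a) * P y (snd p + a) +
      y / ((fst p + a)\<^sup>2 + y\<^sup>2) * (y / ((snd p + a)\<^sup>2 + y\<^sup>2))) / (2 * pi))"
  have K: "has_bochner_integral lborel (\<lambda>y. K y p) (1 / (fst p + snd p + 2 * a))" "0 \<le> K y p"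
    if nz: "rho_pair p \<noteq> 0" for p y
  proof -
    define u v where "u = fst p + a" and "v = snd p + a"
    have uv: "0 < u" "0 < v"
      using rho_pair_nonzero[OF nz] a by (auto simp: u_def v_def)
    have "K y p = 1 / (2 * pi * (u + v)) * (P y u + P y v)" for y
    proof -
      have nz: "u\<^sup>2 + y\<^sup>2 \<noteq> 0" "v\<^sup>2 + y\<^sup>2 \<noteq> 0" "u + v \<noteq> 0"
        using uv by (auto simp: add_nonneg_eq_0_iff)
      have "P y u * P y v + y / (u\<^sup>2 + y\<^sup>2) * (y / (v\<^sup>2 + y\<^sup>2)) = (u * v + y\<^sup>2) / ((u\<^sup>2 + y\<^sup>2) * (v\<^sup>2 + y\<^sup>2))"
        by (simp add: P_def add_divide_distrib power2_eq_square)
      \<comment> \<open>Expanding the fraction by \<open>u + v\<close> lets the numerator split into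
        one multiple of each denominator factor, hence into two Poisson kernels.\<close>
      also have "\<dots> = ((u * v + y\<^sup>2) * (u + v)) / ((u\<^sup>2 + y\<^sup>2) * (v\<^sup>2 + y\<^sup>2) * (u + v))"
        using nz by simp
      also have "(u * v + y\<^sup>2) * (u + v) = u * (v\<^sup>2 + y\<^sup>2) + v * (u\<^sup>2 + y\<^sup>2)"
        by (simp add: algebra_simps power2_eq_square)
      also have "\<dots> / ((u\<^sup>2 + y\<^sup>2) * (v\<^sup>2 + y\<^sup>2) * (u + v)) = (P y u + P y v) / (u + v)"
        using nz by (simp add: P_def add_divide_distrib)
      finally show ?thesis
        by (simp add: K_def u_def v_def)
    qed
    moreover have "has_bochner_integral lborel (\<lambda>y. 1 / (2 * pi * (u + v)) * (P y u + P y v))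
        (1 / (2 * pi * (u + v)) * (pi + pi))"
      unfolding P_def
      by (intro has_bochner_integral_mult_right has_bochner_integral_add has_bochner_integral_Poisson_kernel uv)
    moreover have "1 / (2 * pi * (u + v)) * (pi + pi) = 1 / (u + v)"
      by simp
    moreover have "u + v = fst p + snd p + 2 * a"
      by (simp add: u_def v_def)
    ultimately show "has_bochner_integral lborel (\<lambda>y. K y p) (1 / (fst p + snd p + 2 * a))"
      by simp
    have "0 \<le> P y u * P y v + y\<^sup>2 / ((u\<^sup>2 + y\<^sup>2) * (v\<^sup>2 + y\<^sup>2))"
      using uv unfolding P_def by (intro add_nonneg_nonneg mult_nonneg_nonneg divide_nonneg_nonneg) auto
    then show "0 \<le> K y p"
      by (simp add: K_def u_def v_def power2_eq_square[of y])
  qed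
  have form: "has_bochner_integral lborel (\<lambda>y. LINT p|lborel. rho_pair p * K y p) (rho_form a)"
    unfolding rho_form_def
  proof (rule lborel_pair.has_bochner_integral_nonneg_kernel)
    show "(\<lambda>(y, p). rho_pair p * K y p) \<in> borel_measurable (lborel \<Otimes>\<^sub>M lborel)"
      unfolding K_def P_def by measurable
  qed (use K integrable_rho_form[OF a] in auto)
  have eq: "AE y in lborel. (norm (1 - G (Complex a y)))\<^sup>2 / (2 * pi) = (LINT p|lborel. rho_pair p * K y p)"
    using AE_lborel_singleton[of "0::real"]
  proof eventually_elim
    case (elim y)
    then show ?case
      using norm_one_minus_G_square[OF a, of y]
      by (simp add: K_def P_def flip: Bochner_Integration.integral_divide_zero)
  qed
  \<comment> \<open>Since \<open>rho\<close> changes sign, nonnegativity is read off from the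
    squared norm instead of the double integral.\<close>
  have nonneg: "AE y in lborel. 0 \<le> (LINT p|lborel. rho_pair p * K y p)"
    using eq by eventually_elim (erule subst, simp)
  have "(\<integral>\<^sup>+ y. ennreal ((norm (1 - G (Complex a y)))\<^sup>2 / (2 * pi)) \<partial>lborel) =
      (\<integral>\<^sup>+ y. ennreal (LINT p|lborel. rho_pair p * K y p) \<partial>lborel)"
    using eq by (intro nn_integral_cong_AE) auto
  also have "\<dots> = ennreal (rho_form a)"
    using form nonneg by (subst nn_integral_eq_integral) (auto simp: has_bochner_integral_iff)
  finally show ?thesis .
qed

theorem proposition1p4:
  shows "square_integrable_on phi {0..} \<and>
         ((\<lambda>a. \<integral>\<^sup>+ t. ennreal ((norm (1 - G (Complex a t)))\<^sup>2 / (2 * pi)) \<partial>lborel) \<longlongrightarrow>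
          (\<integral>\<^sup>+ t. ennreal ((norm (1 - G (Complex 0 t)))\<^sup>2 / (2 * pi)) \<partial>lborel)) (at_right 0) \<and>
         (\<integral>\<^sup>+ t. ennreal ((norm (1 - G (Complex 0 t)))\<^sup>2 / (2 * pi)) \<partial>lborel) =
          (\<integral>\<^sup>+ s\<in>{0..}. ennreal ((phi s)\<^sup>2) \<partial>lborel)"
proof (intro conjI)
  show "square_integrable_on phi {0..}"
    using has_bochner_integral_phi_square
    unfolding square_integrable_on_def set_borel_measurable_def set_integrable_def
    by (auto simp: has_bochner_integral_iff)
  \<comment> \<open>The integrals over vertical lines are values of \<open>rho_form\<close>, so the
    limit is its right continuity at 0.\<close>
  have "((\<lambda>a. ennreal (rho_form a)) \<longlongrightarrow> ennreal (rho_form 0)) (at_right 0)"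
    by (intro tendsto_ennrealI tendsto_rho_form)
  moreover have "eventually (\<lambda>a. ennreal (rho_form a) =
      (\<integral>\<^sup>+ t. ennreal ((norm (1 - G (Complex a t)))\<^sup>2 / (2 * pi)) \<partial>lborel)) (at_right 0)"
    using eventually_at_right_less[of "0::real"]
    by eventually_elim (simp add: nn_integral_one_minus_G_square)
  ultimately show "((\<lambda>a. \<integral>\<^sup>+ t. ennreal ((norm (1 - G (Complex a t)))\<^sup>2 / (2 * pi)) \<partial>lborel) \<longlongrightarrow>
          (\<integral>\<^sup>+ t. ennreal ((norm (1 - G (Complex 0 t)))\<^sup>2 / (2 * pi)) \<partial>lborel)) (at_right 0)"
    unfolding nn_integral_one_minus_G_square[of 0, simplified] by (rule Lim_transform_eventually)
  have "(\<integral>\<^sup>+ s\<in>{0..}. ennreal ((phi s)\<^sup>2) \<partial>lborel) =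
      (\<integral>\<^sup>+ s. ennreal (indicator {0..} s * (phi s)\<^sup>2) \<partial>lborel)"
    by (simp add: ennreal_mult' ennreal_indicator mult.commute)
  also have "\<dots> = ennreal (rho_form 0)"
    using has_bochner_integral_phi_square
    by (subst nn_integral_eq_integral) (auto simp: has_bochner_integral_iff)
  finally show "(\<integral>\<^sup>+ t. ennreal ((norm (1 - G (Complex 0 t)))\<^sup>2 / (2 * pi)) \<partial>lborel) =
          (\<integral>\<^sup>+ s\<in>{0..}. ennreal ((phi s)\<^sup>2) \<partial>lborel)"
    by (simp add: nn_integral_one_minus_G_square)
qed

end
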